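(* The portrait growth sequence $\{a_n\}_{n=0}^\infty$ of the first Grigorchuk group $\mathcal{G}$ (with respect to the nucleus of $\mathcal{G}$) is given recursively by $$a_0 = 5,\qquad a_n = 2x_n + 4y_n + 2z_n + 2X_n + 4Y_n + 2Z_n \quad\text{for } n \geq 1,$$ where $x_n, y_n, z_n, X_n, Y_n, Z_n$, for $n \geq 1$, satisfy the system of recursive relations \begin{align*} x_{n+1} &= x_n^2 + 2y_n^2 + z_n^2,\\ y_{n+1} &= x_n Y_n+ Y_n z_n + X_n y_n + y_n Z_n,\\ z_{n+1} &= X_n^2 + 2Y_n^2 + Z_n^2,\\ X_{n+1} &= 2x_n y_n+ 2y_n z_n,\\ Y_{n+1} &= x_nX_n + 2y_nY_n + z_nZ_n,\\ Z_{n+1} &= 2X_n Y_n + 2 Y_n Z_n, \end{align*} with initial conditions $x_1 = y_1 = z_1 = Y_1 =1$, $X_1 =2$, $Z_1 =0$.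
   Context: Let $X=\{1,\dots,d\}$ and let $T$ be the $d$-adic rooted tree whose vertices are the finite words over $X$, with $u$ joined to $ux$ for $x \in X$; words of length $n$ form level $n$. $\operatorname{Aut} T$ is the group of automorphisms of this rooted tree. Every $g\in\operatorname{Aut} T$ is written $g=(g_1,\dots,g_d)\alpha$ with $\alpha\in S_d$ and $g_i\in \operatorname{Aut} T$, meaning $g(iw)=\alpha(i)\,g_i(w)$ for $i\in X$ and every word $w$; $g_i$ is the section of $g$ at $i$. The section $g_u$ at any vertex $u$ is defined by $g(uw)=g(u)g_u(w)$. Products are composed so that $gh$ means first $g$, then $h$, i.e. $(gh)_u=g_u h_{g(u)}$. A group $G\le\operatorname{Aut} T$ is self-similar if all sections of its elements lie in $G$. A self-similar group $G$ is contracting if there is a finite set $\mathcal{M}\subseteq G$ such that for every $g\in G$ there is a level $n$ such that all sections of $g$ at vertices at and below level $n$ belong to $\mathcal{M}$. The smallest such $\mathcal{M}$ is the nucleus $\mathcal{N}(G)$. For a contracting group $G$, the nucleus portrait of $g\in G$ is the finite decorated rooted tree defined recursively: if $g\in\mathcal{N}(G)$, it is a single root decorated by $g$; otherwise, with $g=(g_1,\dots,g_d)\alpha$, the root is decorated by $\alpha$ and the portraits of $g_1,\dots,g_d$ are attached at the $d$ vertices of level 1. The depth $d(g)$ is the length of the longest path from the root to a leaf of the portrait (equivalently, the least $n$ such that all sections of $g$ at level $n$ lie in $\mathcal{N}(G)$). The portrait growth sequence of a finitely generated contracting group $G$ is $a_n=|\{g\in G\mid d(g)\le n\}|$, $n\ge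 0$. The first Grigorchuk group $\mathcal{G}$ is the group of automorphisms of the binary tree ($d=2$) generated by $a=(1,1)(1\,2)$ and the elements $b,c,d$ fixing level 1 and defined recursively by $b=(a,c)$, $c=(a,d)$, $d=(1,b)$. It is contracting with nucleus $\{1,a,b,c,d\}$. *)

theory Defs
  imports "HOL-Algebra.Generated_Groups"
begin

text \<open>The alphabet is a finite type \<open>'x\<close>, whose cardinality is the arity of the tree;
  the vertices of the tree are the words over it, the root being the empty word.\<close>

definition tree_adj :: "'x list \<Rightarrow> 'x list \<Rightarrow> bool" where
  "tree_adj u v \<longleftrightarrow> (\<exists>x. v = u @ [x] \<or> u = v @ [x])"

definition tree_automorphism :: "('x list \<Rightarrow> 'x list) \<Rightarrow> bool" where
  "tree_automorphism g \<longleftrightarrow>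
     bij g \<and> g [] = [] \<and> (\<forall>u v. tree_adj (g u) (g v) \<longleftrightarrow> tree_adj u v)"

text \<open>The product of \<open>g\<close> and \<open>h\<close> means first \<open>g\<close>, then \<open>h\<close>.\<close>

definition AutT :: "('x list \<Rightarrow> 'x list) monoid" where
  "AutT = \<lparr>carrier = {g. tree_automorphism g}, mult = (\<lambda>g h. h \<circ> g), one = id\<rparr>"

text \<open>For a tree automorphism \<open>g\<close> the word \<open>g u\<close> is the prefix of \<open>g (u @ w)\<close> of length
  \<open>length u\<close>, so this is the map \<open>g\<^sub>u\<close> determined by \<open>g (u @ w) = g u @ g\<^sub>u w\<close>.\<close>

definition tree_section :: "('x list \<Rightarrow> 'x list) \<Rightarrow> 'x list \<Rightarrow> 'x list \<Rightarrow> 'x list" where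
  "tree_section g u w = drop (length u) (g (u @ w))"

definition root_perm :: "('x list \<Rightarrow> 'x list) \<Rightarrow> 'x \<Rightarrow> 'x" where
  "root_perm g i = hd (g [i])"

definition contracting_set ::
    "('x list \<Rightarrow> 'x list) set \<Rightarrow> ('x list \<Rightarrow> 'x list) set \<Rightarrow> bool" where
  "contracting_set G M \<longleftrightarrow>
     finite M \<and> M \<subseteq> G \<and> (\<forall>g\<in>G. \<exists>n. \<forall>u. length u \<ge> n \<longrightarrow> tree_section g u \<in> M)"

text \<open>\<open>LEAST\<close> is with respect to inclusion; the value is meaningful for contracting \<open>G\<close>.\<close>

definition nucleus :: "('x list \<Rightarrow> 'x list) set \<Rightarrow> ('x list \<Rightarrow> 'x list) set" where
  "nucleus G = (LEAST M. contracting_set G M)"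

datatype 'x portrait =
    Leaf "'x list \<Rightarrow> 'x list"
  | Node "'x \<Rightarrow> 'x" "'x \<Rightarrow> 'x portrait"

primrec portrait_height :: "('x::finite) portrait \<Rightarrow> nat" where
  "portrait_height (Leaf g) = 0"
| "portrait_height (Node \<alpha> P) = Suc (Max (range (\<lambda>i. portrait_height (P i))))"

text \<open>The recursion defining the portrait terminates only for elements of a contracting group,
  hence it is rendered as an inductive relation. It is functional, and every element of a
  self-similar contracting group has a portrait.\<close>

inductive is_portrait ::
    "('x list \<Rightarrow> 'x list) set \<Rightarrow> ('x list \<Rightarrow> 'x list) \<Rightarrow> 'x portrait \<Rightarrow> bool"
  for N where
  leaf: "g \<in> N \<Longrightarrow> is_portrait N g (Leaf g)"
| node: "g \<notin> N \<Longrightarrow> (\<And>i. is_portrait N (tree_section g [i]) (P i)) \<Longrightarrow>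
         is_portrait N g (Node (root_perm g) P)"

definition nucleus_portrait ::
    "('x list \<Rightarrow> 'x list) set \<Rightarrow> ('x list \<Rightarrow> 'x list) \<Rightarrow> 'x portrait" where
  "nucleus_portrait G g = (THE P. is_portrait (nucleus G) g P)"

definition depth :: "(('x::finite) list \<Rightarrow> 'x list) set \<Rightarrow> ('x list \<Rightarrow> 'x list) \<Rightarrow> nat" where
  "depth G g = portrait_height (nucleus_portrait G g)"

definition portrait_growth :: "(('x::finite) list \<Rightarrow> 'x list) set \<Rightarrow> nat \<Rightarrow> nat" where
  "portrait_growth G n = card {g \<in> G. depth G g \<le> n}"

text \<open>The letters 1 and 2 of the binary alphabet are \<open>False\<close> and \<open>True\<close>.\<close>

fun grig_a :: "bool list \<Rightarrow> bool list" where
  "grig_a [] = []"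
| "grig_a (x # w) = (\<not> x) # w"

fun grig_b grig_c grig_d :: "bool list \<Rightarrow> bool list" where
  "grig_b [] = []"
| "grig_b (False # w) = False # grig_a w"
| "grig_b (True # w) = True # grig_c w"
| "grig_c [] = []"
| "grig_c (False # w) = False # grig_a w"
| "grig_c (True # w) = True # grig_d w"
| "grig_d [] = []"
| "grig_d (False # w) = False # w"
| "grig_d (True # w) = True # grig_b w"

definition grigorchuk :: "(bool list \<Rightarrow> bool list) set" where
  "grigorchuk = generate AutT {grig_a, grig_b, grig_c, grig_d}"

end

theory Submission
  imports Defs
begin

text \<open>A pair \<open>(f, g)\<close> of elements of the group occurs as the pair of level-one sections of an element
  iff the images of \<open>f\<close> and \<open>g\<close> in the dihedral quotient \<open>\<langle>a, d\<rangle>\<close> of order 8 correspond under the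
  automorphism exchanging \<open>a\<close> and \<open>d\<close>; the root permutation is arbitrary. An element has depth
  at most \<open>n + 1\<close> iff both sections have depth at most \<open>n\<close>. The dihedral quotient is too
  small to iterate the count, but it factors through a quotient of order 16 in which the image of
  an element is determined by its root permutation and the images of its two sections.
  Hence the numbers of elements of depth at most \<open>n\<close> in the 16 classes satisfy a quadratic
  recursion. For \<open>n \<ge> 1\<close> they do not depend on the root permutation, and the remaining
  8 numbers are \<open>x\<close>, \<open>z\<close>, \<open>X\<close>, \<open>Z\<close> once each and \<open>y\<close>, \<open>Y\<close> twice each.\<close>

section \<open>Portraits\<close>

lemma tree_section_Nil [simp]: "tree_section f [] = f"
  by (simp add: fun_eq_iff tree_section_def)

lemma tree_section_Cons: "tree_section f (i # u) = tree_section (tree_section f [i]) u"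
  by (simp add: fun_eq_iff tree_section_def)

lemma is_portrait_unique:
  assumes "is_portrait N g P" "is_portrait N g Q"
  shows "P = Q"
  using assms
proof (induction arbitrary: Q rule: is_portrait.induct)
  case (leaf g)
  from leaf.prems leaf.hyps show ?case by cases auto
next
  case (node g P)
  from node.prems show ?case
  proof cases
    case leaf
    with node.hyps show ?thesis by auto
  next
    case (node P')
    then show ?thesis using node.IH by (auto simp: fun_eq_iff)
  qed
qed

lemma is_portrait_exists:
  assumes "\<And>u. length u \<ge> n \<Longrightarrow> tree_section g u \<in> N"
  shows "\<exists>P. is_portrait N g P"
  using assms
proof (induction n arbitrary: g)
  case 0
  then have "g \<in> N" by (metis le0 tree_section_Nil)
  then show ?case by (blast intro: is_portrait.leaf)
next
  case (Suc n)
  have "\<exists>P. is_portrait N (tree_section g [i]) P" for i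
  proof (rule Suc.IH)
    fix u :: "'a list"
    assume "n \<le> length u"
    then show "tree_section (tree_section g [i]) u \<in> N"
      using Suc.prems [of "i # u"] by (simp add: tree_section_Cons [symmetric])
  qed
  then obtain P where "\<And>i. is_portrait N (tree_section g [i]) (P i)" by metis
  then show ?case by (cases "g \<in> N") (blast intro: is_portrait.intros)+
qed

lemma contracting_nucleus_portrait:
  assumes "contracting_set G (nucleus G)" "g \<in> G"
  shows "is_portrait (nucleus G) g (nucleus_portrait G g)"
proof -
  obtain n where "\<And>u. length u \<ge> n \<Longrightarrow> tree_section g u \<in> nucleus G"
    using assms unfolding contracting_set_def by blast
  then obtain P where "is_portrait (nucleus G) g P"
    using is_portrait_exists by blast
  then show ?thesis
    unfolding nucleus_portrait_def by (rule theI) (metis is_portrait_unique \<open>is_portrait _ g P\<close>)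
qed

lemma depth_le_0_iff:
  assumes "contracting_set G (nucleus G)" "g \<in> G"
  shows "depth G g \<le> 0 \<longleftrightarrow> g \<in> nucleus G"
  using contracting_nucleus_portrait [OF assms]
  unfolding depth_def by cases auto

text \<open>Closure of the nucleus under sections settles the leaf case: both sides hold because all
  depths involved are 0.\<close>

lemma depth_le_Suc_iff:
  fixes g :: "('x::finite) list \<Rightarrow> 'x list"
  assumes G: "contracting_set G (nucleus G)" "g \<in> G"
    and self_similar: "\<And>i. tree_section g [i] \<in> G"
    and sec_nucleus: "\<And>i. g \<in> nucleus G \<Longrightarrow> tree_section g [i] \<in> nucleus G"
  shows "depth G g \<le> Suc n \<longleftrightarrow> (\<forall>i. depth G (tree_section g [i]) \<le> n)"
  using contracting_nucleus_portrait [OF G]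
proof cases
  case leaf
  then have "depth G g = 0" "\<And>i. depth G (tree_section g [i]) \<le> 0"
    using depth_le_0_iff [OF G(1) self_similar] sec_nucleus by (auto simp: depth_def)
  then show ?thesis by simp
next
  case (node P)
  then have "P i = nucleus_portrait G (tree_section g [i])" for i
    using is_portrait_unique contracting_nucleus_portrait [OF G(1) self_similar] by blast
  then show ?thesis
    using node(1) by (auto simp: depth_def)
qed

section \<open>The Grigorchuk group\<close>

text \<open>Encodes (f0, f1)alpha with \<open>True\<close> for the transposition;
  \<open>\<noteq>\<close> on bits is addition mod 2, here and throughout.\<close>

definition node :: "bool \<Rightarrow> (bool list \<Rightarrow> bool list) \<Rightarrow> (bool list \<Rightarrow> bool list) \<Rightarrow> bool list \<Rightarrow> bool list" where
  "node \<alpha> f0 f1 w = (case w of [] \<Rightarrow> [] | i # v \<Rightarrow> (i \<noteq> \<alpha>) # (if i then f1 else f0) v)"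

lemma node_simps [simp]:
  "node \<alpha> f0 f1 [] = []"
  "node \<alpha> f0 f1 (i # v) = (i \<noteq> \<alpha>) # (if i then f1 else f0) v"
  by (simp_all add: node_def)

lemma node_comp:
  "node \<beta> g0 g1 \<circ> node \<alpha> f0 f1 =
    node (\<alpha> \<noteq> \<beta>) ((if \<alpha> then g1 else g0) \<circ> f0) ((if \<alpha> then g0 else g1) \<circ> f1)"
proof
  show "(node \<beta> g0 g1 \<circ> node \<alpha> f0 f1) w =
    node (\<alpha> \<noteq> \<beta>) ((if \<alpha> then g1 else g0) \<circ> f0) ((if \<alpha> then g0 else g1) \<circ> f1) w" for w
    by (cases w) auto
qed

definition root_bit :: "(bool list \<Rightarrow> bool list) \<Rightarrow> bool" where
  "root_bit f = hd (f [False])"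

abbreviation sec :: "(bool list \<Rightarrow> bool list) \<Rightarrow> bool \<Rightarrow> bool list \<Rightarrow> bool list" where
  "sec f i \<equiv> tree_section f [i]"

lemma root_bit_node [simp]: "root_bit (node \<alpha> f0 f1) = \<alpha>"
  by (simp add: root_bit_def)

lemma sec_node [simp]: "sec (node \<alpha> f0 f1) i = (if i then f1 else f0)"
  by (simp add: fun_eq_iff tree_section_def)

lemma node_eq_iff [simp]:
  "node \<alpha> f0 f1 = node \<beta> g0 g1 \<longleftrightarrow> \<alpha> = \<beta> \<and> f0 = g0 \<and> f1 = g1"
proof
  assume eq: "node \<alpha> f0 f1 = node \<beta> g0 g1"
  show "\<alpha> = \<beta> \<and> f0 = g0 \<and> f1 = g1"
    using arg_cong [OF eq, of root_bit] arg_cong [OF eq, of "\<lambda>f. sec f False"]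
      arg_cong [OF eq, of "\<lambda>f. sec f True"] by simp
qed simp

lemma node_id: "node False id id = id"
proof
  show "node False id id w = id w" for w by (cases w) auto
qed

lemma grig_node:
  "grig_a = node True id id"
  "grig_b = node False grig_a grig_c"
  "grig_c = node False grig_a grig_d"
  "grig_d = node False id grig_b"
proof -
  show "grig_a = node True id id"
  proof
    show "grig_a w = node True id id w" for w by (cases w) auto
  qed
  show "grig_b = node False grig_a grig_c"
  proof
    show "grig_b w = node False grig_a grig_c w" for w
      by (cases w rule: grig_b.cases) auto
  qed
  show "grig_c = node False grig_a grig_d"
  proof
    show "grig_c w = node False grig_a grig_d w" for w
      by (cases w rule: grig_c.cases) auto
  qed
  show "grig_d = node False id grig_b"
  proof
    show "grig_d w = node False id grig_b w" for w
      by (cases w rule: grig_d.cases) auto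
  qed
qed

lemma grig_a_sq: "grig_a \<circ> grig_a = id"
  by (simp add: grig_node(1) node_comp node_id)

lemma grig_a_sq_apply [simp]: "grig_a (grig_a w) = w"
  by (cases w) auto

text \<open>Below the letter \<open>True\<close> each identity turns into another of the list by the
  cycle b -> c -> d -> b, hence the simultaneous induction.\<close>

lemma klein_apply:
  "grig_b (grig_b w) = w \<and> grig_c (grig_c w) = w \<and> grig_d (grig_d w) = w \<and>
   grig_b (grig_c w) = grig_d w \<and> grig_c (grig_b w) = grig_d w \<and>
   grig_b (grig_d w) = grig_c w \<and> grig_d (grig_b w) = grig_c w \<and>
   grig_c (grig_d w) = grig_b w \<and> grig_d (grig_c w) = grig_b w"
proof (induction w)
  case (Cons i w)
  then show ?case by (cases i) auto
qed simp

lemma klein: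
  "grig_b \<circ> grig_b = id" "grig_c \<circ> grig_c = id" "grig_d \<circ> grig_d = id"
  "grig_b \<circ> grig_c = grig_d" "grig_c \<circ> grig_b = grig_d"
  "grig_b \<circ> grig_d = grig_c" "grig_d \<circ> grig_b = grig_c"
  "grig_c \<circ> grig_d = grig_b" "grig_d \<circ> grig_c = grig_b"
  using klein_apply by (auto simp: fun_eq_iff)

section \<open>Membership in the group and induction over generators\<close>

abbreviation gens :: "(bool list \<Rightarrow> bool list) set" where
  "gens \<equiv> {grig_a, grig_b, grig_c, grig_d}"

lemma gens_involution: "s \<in> gens \<Longrightarrow> s \<circ> s = id"
  using grig_a_sq klein by auto

lemma grig_snoc:
  "(\<exists>y. grig_a (u @ [x]) = grig_a u @ [y]) \<and> (\<exists>y. grig_b (u @ [x]) = grig_b u @ [y]) \<and>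
   (\<exists>y. grig_c (u @ [x]) = grig_c u @ [y]) \<and> (\<exists>y. grig_d (u @ [x]) = grig_d u @ [y])"
proof (induction u)
  case Nil
  then show ?case by (cases x) auto
next
  case (Cons i u)
  have "\<exists>y. grig_a (u @ [x]) = grig_a u @ [y]" using Cons by blast
  with Cons show ?case by (cases i) auto
qed

lemma gens_tree_automorphism:
  assumes "s \<in> gens"
  shows "tree_automorphism s"
proof -
  have inv: "s (s w) = w" for w
    using gens_involution [OF assms] by (metis comp_apply id_apply)
  have snoc: "\<exists>y. s (u @ [x]) = s u @ [y]" for u x
    using assms grig_snoc [of u x] by auto
  have adj: "tree_adj (s u) (s v)" if "tree_adj u v" for u v
    using that snoc unfolding tree_adj_def by metis
  have "bij s" using gens_involution [OF assms] o_bij by blast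
  moreover have "s [] = []" using assms by auto
  ultimately show ?thesis
    using adj inv unfolding tree_automorphism_def by metis
qed

lemma inv_AutT_gens:
  assumes "s \<in> gens"
  shows "inv\<^bsub>AutT\<^esub> s = s"
  unfolding m_inv_def
proof (rule the_equality)
  show "s \<in> carrier AutT \<and> s \<otimes>\<^bsub>AutT\<^esub> s = \<one>\<^bsub>AutT\<^esub> \<and> s \<otimes>\<^bsub>AutT\<^esub> s = \<one>\<^bsub>AutT\<^esub>"
    using gens_tree_automorphism [OF assms] gens_involution [OF assms] by (simp add: AutT_def)
  show "y = s" if "y \<in> carrier AutT \<and> s \<otimes>\<^bsub>AutT\<^esub> y = \<one>\<^bsub>AutT\<^esub> \<and> y \<otimes>\<^bsub>AutT\<^esub> s = \<one>\<^bsub>AutT\<^esub>" for y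
  proof -
    have "y \<circ> s = id" using that by (simp add: AutT_def)
    then have "y \<circ> s \<circ> s = s" by simp
    then show ?thesis using gens_involution [OF assms] by (simp add: comp_assoc)
  qed
qed

lemma grigorchuk_id: "id \<in> grigorchuk"
  using generate.one [of AutT gens] by (simp add: grigorchuk_def AutT_def)

lemma grigorchuk_gens: "s \<in> gens \<Longrightarrow> s \<in> grigorchuk"
  by (simp add: grigorchuk_def generate.incl)

lemma grigorchuk_comp: "f \<in> grigorchuk \<Longrightarrow> g \<in> grigorchuk \<Longrightarrow> g \<circ> f \<in> grigorchuk"
  using generate.eng [of f AutT gens g] by (simp add: grigorchuk_def AutT_def)

text \<open>Rule \<open>eng\<close> of \<open>generate\<close> multiplies two arbitrary elements.
  Proving the claim for \<open>f \<circ> g\<close>, with any \<open>g\<close> satisfying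
  \<open>P\<close>, absorbs such a product factor by factor; inverses reduce to generators, which
  are involutions.\<close>

lemma grigorchuk_induct [consumes 1, case_names id step]:
  assumes "f \<in> grigorchuk" and id: "P id"
    and step: "\<And>f s. f \<in> grigorchuk \<Longrightarrow> s \<in> gens \<Longrightarrow> P f \<Longrightarrow> P (s \<circ> f)"
  shows "P f"
proof -
  have gen: "h \<circ> g \<in> grigorchuk \<and> P (h \<circ> g)"
    if "h \<in> gens" "g \<in> grigorchuk" "P g" for h g
    using step [OF that(2,1,3)] grigorchuk_comp [OF that(2) grigorchuk_gens [OF that(1)]] by blast
  have "f \<circ> g \<in> grigorchuk \<and> P (f \<circ> g)" if "g \<in> grigorchuk" "P g" for g
    using assms(1) [unfolded grigorchuk_def] that
  proof (induction arbitrary: g rule: generate.induct)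
    case one
    then show ?case by (simp add: AutT_def)
  next
    case (incl h)
    then show ?case by (rule gen)
  next
    case (inv h)
    then show ?case unfolding inv_AutT_gens [OF inv(1)] by (rule gen)
  next
    case (eng h1 h2)
    have "h1 \<otimes>\<^bsub>AutT\<^esub> h2 \<circ> g = h2 \<circ> (h1 \<circ> g)"
      by (simp add: AutT_def comp_assoc)
    then show ?case
      using eng.IH(2) eng.IH(1) [OF eng.prems] by (simp only:)
  qed
  from this [OF grigorchuk_id id] show ?thesis by simp
qed

lemma grigorchuk_inverse:
  assumes "f \<in> grigorchuk"
  obtains f' where "f' \<in> grigorchuk" "f' \<circ> f = id"
proof -
  have "\<exists>f'\<in>grigorchuk. f' \<circ> f = id"
    using assms
  proof (induction rule: grigorchuk_induct)
    case id
    show ?case using grigorchuk_id by (intro bexI [of _ id]) simp_all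
  next
    case (step f s)
    then obtain f' where f': "f' \<in> grigorchuk" "f' \<circ> f = id" by blast
    have "f' \<circ> s \<circ> (s \<circ> f) = f' \<circ> (s \<circ> s) \<circ> f" by (simp add: comp_assoc)
    also have "\<dots> = id" using gens_involution [OF step(2)] f' by simp
    finally show ?case using grigorchuk_comp grigorchuk_gens step(2) f'(1) by blast
  qed
  then show ?thesis using that by blast
qed

lemma grigorchuk_cases:
  assumes "f \<in> grigorchuk"
  obtains \<alpha> f0 f1 where "f = node \<alpha> f0 f1" "f0 \<in> grigorchuk" "f1 \<in> grigorchuk"
proof -
  have "\<exists>\<alpha> f0 f1. f = node \<alpha> f0 f1 \<and> f0 \<in> grigorchuk \<and> f1 \<in> grigorchuk"
    using assms
  proof (induction rule: grigorchuk_induct)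
    case id
    then show ?case using grigorchuk_id node_id by metis
  next
    case (step f s)
    have "\<exists>\<beta> s0 s1. s = node \<beta> s0 s1 \<and> s0 \<in> grigorchuk \<and> s1 \<in> grigorchuk"
      using step(2) by (blast intro: grig_node grigorchuk_id grigorchuk_gens)
    with step(3) obtain \<alpha> f0 f1 \<beta> s0 s1 where
      "f = node \<alpha> f0 f1" "f0 \<in> grigorchuk" "f1 \<in> grigorchuk"
      "s = node \<beta> s0 s1" "s0 \<in> grigorchuk" "s1 \<in> grigorchuk" by blast
    then show ?case
      using grigorchuk_comp by (cases \<alpha>) (simp_all add: node_comp)
  qed
  then show ?thesis using that by blast
qed

lemma sec_grigorchuk: "f \<in> grigorchuk \<Longrightarrow> sec f i \<in> grigorchuk"
  by (erule grigorchuk_cases) simp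

lemma root_bit_comp: "f \<in> grigorchuk \<Longrightarrow> g \<in> grigorchuk \<Longrightarrow> root_bit (g \<circ> f) = (root_bit f \<noteq> root_bit g)"
  by (erule grigorchuk_cases [of f], erule grigorchuk_cases [of g]) (simp add: node_comp)

lemma sec_comp:
  "f \<in> grigorchuk \<Longrightarrow> g \<in> grigorchuk \<Longrightarrow> sec (g \<circ> f) i = sec g (i \<noteq> root_bit f) \<circ> sec f i"
  by (erule grigorchuk_cases [of f], erule grigorchuk_cases [of g]) (auto simp: node_comp)

section \<open>Contraction and the nucleus\<close>

definition grig_nucleus :: "(bool list \<Rightarrow> bool list) set" where
  "grig_nucleus = {id, grig_a, grig_b, grig_c, grig_d}"

lemma sec_gens:
  "sec id i = id" "sec grig_a i = id"
  "sec grig_b i = (if i then grig_c else grig_a)"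
  "sec grig_c i = (if i then grig_d else grig_a)"
  "sec grig_d i = (if i then grig_b else id)"
  \<comment> \<open>Used directly as rewrite rules, the equations \<open>grig_node\<close> would
    loop through b, c and d.\<close>
  by (metis node_id sec_node) (simp_all add: grig_node [THEN arg_cong [where f = "\<lambda>f. sec f i"]])

lemma root_bit_gens:
  "\<not> root_bit id" "root_bit grig_a" "\<not> root_bit grig_b" "\<not> root_bit grig_c" "\<not> root_bit grig_d"
  by (simp_all add: root_bit_def)

lemma grig_nucleus_subset: "grig_nucleus \<subseteq> grigorchuk"
  using grigorchuk_id grigorchuk_gens by (auto simp: grig_nucleus_def)

lemma sec_grig_nucleus: "f \<in> grig_nucleus \<Longrightarrow> sec f i \<in> grig_nucleus"
  by (auto simp: grig_nucleus_def sec_gens)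

lemma section_grig_nucleus: "f \<in> grig_nucleus \<Longrightarrow> tree_section f u \<in> grig_nucleus"
proof (induction u arbitrary: f)
  case (Cons i u)
  then show ?case using sec_grig_nucleus tree_section_Cons by metis
qed simp

text \<open>If a factor is \<open>id\<close> or a, its section is trivial. Otherwise both sections
  lie in {1, a} on the left, and in the Klein group {1, b, c, d} on the right.\<close>

lemma sec_nucleus_comp:
  assumes "f \<in> grig_nucleus" "g \<in> grig_nucleus"
  shows "sec (g \<circ> f) i \<in> grig_nucleus"
proof -
  have "sec (g \<circ> f) i = sec g (i \<noteq> root_bit f) \<circ> sec f i"
    using sec_comp grig_nucleus_subset assms by blast
  then show ?thesis
    using assms unfolding grig_nucleus_def
    by (auto simp: sec_gens root_bit_gens klein grig_a_sq)
qed

lemma section_comp: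
  assumes "f \<in> grigorchuk" "g \<in> grigorchuk"
  obtains v where "length v = length u"
    "tree_section (g \<circ> f) u = tree_section g v \<circ> tree_section f u"
proof -
  have "\<exists>v. length v = length u \<and> tree_section (g \<circ> f) u = tree_section g v \<circ> tree_section f u"
    using assms
  proof (induction u arbitrary: f g)
    case (Cons i u)
    obtain v where "length v = length u" "tree_section (sec g (i \<noteq> root_bit f) \<circ> sec f i) u =
      tree_section (sec g (i \<noteq> root_bit f)) v \<circ> tree_section (sec f i) u"
      using Cons.IH sec_grigorchuk Cons.prems by metis
    then show ?case
      using sec_comp [OF Cons.prems] tree_section_Cons length_Cons by metis
  qed simp
  then show ?thesis using that by blast
qed

lemma tree_section_append: "tree_section f (u @ v) = tree_section (tree_section f u) v"
  by (simp add: fun_eq_iff tree_section_def add.commute)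

lemma contracting_grig_nucleus: "contracting_set grigorchuk grig_nucleus"
proof -
  have "\<exists>n. \<forall>u. length u \<ge> n \<longrightarrow> tree_section g u \<in> grig_nucleus" if "g \<in> grigorchuk" for g
    using that
  proof (induction rule: grigorchuk_induct)
    case id
    have "id \<in> grig_nucleus" by (simp add: grig_nucleus_def)
    then show ?case using section_grig_nucleus by blast
  next
    case (step f s)
    then obtain n where n: "\<And>u. length u \<ge> n \<Longrightarrow> tree_section f u \<in> grig_nucleus" by blast
    have "tree_section (s \<circ> f) u \<in> grig_nucleus" if len: "length u \<ge> Suc n" for u
    proof -
      \<comment> \<open>At \<open>u'\<close> the section is a product of two nucleus elements; the
        last letter brings it back into the nucleus. Each generator thus costs one level.\<close>
      obtain u' i where u: "u = u' @ [i]" using len by (cases u rule: rev_cases) auto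
      obtain v where v: "tree_section (s \<circ> f) u' = tree_section s v \<circ> tree_section f u'"
        using section_comp step grigorchuk_gens by metis
      have "s \<in> grig_nucleus" using step(2) by (auto simp: grig_nucleus_def)
      then have "sec (tree_section s v \<circ> tree_section f u') i \<in> grig_nucleus"
        using n [of u'] len u section_grig_nucleus sec_nucleus_comp by simp
      then show ?thesis by (simp add: u v tree_section_append)
    qed
    then show ?case by blast
  qed
  then show ?thesis
    using grig_nucleus_subset by (simp add: contracting_set_def grig_nucleus_def)
qed

text \<open>Sections along the rightmost ray have period 3, so b, c and d recur arbitrarily deep and
  belong to every contracting set.\<close>

lemma section_cycle:
  "tree_section f (replicate (3 * n) True) = f" if "f \<in> {grig_b, grig_c, grig_d}"
proof (induction n)
  case (Suc n)
  have "3 * Suc n = Suc (Suc (Suc (3 * n)))" by simp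
  then have "replicate (3 * Suc n) True = [True] @ [True] @ [True] @ replicate (3 * n) True"
    by (simp only: replicate_Suc append.simps)
  then show ?case
    using Suc that by (auto simp only: tree_section_append sec_gens if_True)
qed simp

lemma nucleus_grigorchuk: "nucleus grigorchuk = grig_nucleus"
  unfolding nucleus_def
proof (rule Least_equality)
  show "contracting_set grigorchuk grig_nucleus" by (rule contracting_grig_nucleus)
  show "grig_nucleus \<subseteq> M" if M: "contracting_set grigorchuk M" for M
  proof -
    have *: "tree_section f v \<in> M" if f: "f \<in> {grig_b, grig_c, grig_d}" for f v
    proof -
      obtain n where n: "\<And>u. length u \<ge> n \<Longrightarrow> tree_section f u \<in> M"
        using M f grigorchuk_gens unfolding contracting_set_def by blast
      then have "tree_section f (replicate (3 * n) True @ v) \<in> M" by simp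
      then show ?thesis using section_cycle [OF f] by (simp only: tree_section_append)
    qed
    have "grig_b \<in> M" "grig_c \<in> M" "grig_d \<in> M" using * [of _ "[]"] by auto
    moreover have "grig_a \<in> M" using * [of grig_b "[False]"] by (simp add: sec_gens)
    moreover have "id \<in> M" using * [of grig_d "[False]"] by (simp add: sec_gens)
    ultimately show ?thesis by (simp add: grig_nucleus_def)
  qed
qed

section \<open>The quotient of order 16 and the sections at level one\<close>

text \<open>The four bits \<open>root_bit\<close>, \<open>par1\<close>, \<open>par2\<close>, \<open>twist\<close> are the coordinates of a homomorphism from
  the group onto \<open>C\<^sub>2 \<times> D\<^sub>4\<close> (of order 16), whose kernel is the normal closure of \<open>(ab)\<^sup>2\<close>.
  The first three sum the root permutations over the levels 0, 1 and 2; \<open>twist\<close> does so over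
  the levels 1 and 2 of the right subtree, which is not a homomorphism by itself.\<close>

definition par1 :: "(bool list \<Rightarrow> bool list) \<Rightarrow> bool" where
  "par1 f = (root_bit (sec f False) \<noteq> root_bit (sec f True))"

definition par2 :: "(bool list \<Rightarrow> bool list) \<Rightarrow> bool" where
  "par2 f = (par1 (sec f False) \<noteq> par1 (sec f True))"

definition twist :: "(bool list \<Rightarrow> bool list) \<Rightarrow> bool" where
  "twist f = (root_bit (sec f True) \<noteq> par1 (sec f True))"

lemma par1_comp: "f \<in> grigorchuk \<Longrightarrow> g \<in> grigorchuk \<Longrightarrow> par1 (g \<circ> f) = (par1 f \<noteq> par1 g)"
  by (cases "root_bit f") (auto simp: par1_def sec_comp root_bit_comp sec_grigorchuk)

lemma par2_comp: "f \<in> grigorchuk \<Longrightarrow> g \<in> grigorchuk \<Longrightarrow> par2 (g \<circ> f) = (par2 f \<noteq> par2 g)"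
  by (cases "root_bit f") (auto simp: par2_def sec_comp par1_comp sec_grigorchuk)

text \<open>If f swaps level one, the right section of the product involves the left section of g;
  adding \<open>par1 g\<close> and \<open>par2 g\<close> converts the left-hand sum of g into its
  right-hand one.\<close>

lemma twist_comp:
  assumes "f \<in> grigorchuk" "g \<in> grigorchuk"
  shows "twist (g \<circ> f) = (twist f \<noteq> (twist g \<noteq> (root_bit f \<and> par1 g \<noteq> par2 g)))"
  using assms by (cases "root_bit f") (auto simp: twist_def par2_def par1_def [of g] sec_comp root_bit_comp par1_comp sec_grigorchuk)

lemmas quotient_comp = root_bit_comp par1_comp par2_comp twist_comp

lemma quotient_gens:
  "\<not> par1 id" "\<not> par1 grig_a" "par1 grig_b" "par1 grig_c" "\<not> par1 grig_d"
  "\<not> par2 id" "\<not> par2 grig_a" "par2 grig_b" "\<not> par2 grig_c" "par2 grig_d"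
  "\<not> twist id" "\<not> twist grig_a" "twist grig_b" "\<not> twist grig_c" "twist grig_d"
  by (simp_all add: par1_def par2_def twist_def sec_gens root_bit_gens)

text \<open>Modulo the normal closure of \<open>b\<close> the group becomes the dihedral group of order 8
  generated by \<open>a\<close> and \<open>d\<close>; the relation says that there \<open>g\<close> is the image of \<open>f\<close> under the
  automorphism exchanging \<open>a\<close> and \<open>d\<close>.\<close>

definition matching :: "(bool list \<Rightarrow> bool list) \<Rightarrow> (bool list \<Rightarrow> bool list) \<Rightarrow> bool" where
  "matching f g \<longleftrightarrow> root_bit g = (par1 f \<noteq> par2 f) \<and> (par1 g \<noteq> par2 g) = root_bit f \<and>
     (twist g \<noteq> par2 g) = ((twist f \<noteq> par2 f) \<noteq> (root_bit f \<and> par1 f \<noteq> par2 f))"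

text \<open>With r = \<open>root_bit\<close>, m = \<open>par1\<close> + \<open>par2\<close>, t =
  \<open>twist\<close> + \<open>par2\<close>, a product adds r(f) m(f') to t. Exchanging r and m
  replaces this by m(f) r(f'); the term r(f) m(f) in \<open>matching\<close> accounts for the
  difference.\<close>

lemma matching_comp:
  assumes "f \<in> grigorchuk" "g \<in> grigorchuk" "f' \<in> grigorchuk" "g' \<in> grigorchuk"
    and "matching f g" "matching f' g'"
  shows "matching (f' \<circ> f) (g' \<circ> g)"
  using assms(5,6) unfolding matching_def quotient_comp [OF assms(1,3)] quotient_comp [OF assms(2,4)]
  by argo

lemma matching_sections:
  assumes "f \<in> grigorchuk"
  shows "matching (sec f False) (sec f True)"
  using assms
proof (induction rule: grigorchuk_induct)
  case id
  show "matching (sec id False) (sec id True)"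
    by (simp add: sec_gens matching_def quotient_gens root_bit_gens)
next
  case (step f s)
  have s: "s \<in> grigorchuk" by (rule grigorchuk_gens [OF step(2)])
  \<comment> \<open>Both orders are needed, since f may swap the subtrees before s acts.\<close>
  have "matching (sec s i) (sec s (\<not> i))" for i
    using step(2) by (cases i) (auto simp: sec_gens matching_def quotient_gens root_bit_gens)
  from this [of "root_bit f"] show "matching (sec (s \<circ> f) False) (sec (s \<circ> f) True)"
    using step s by (simp add: sec_comp matching_comp sec_grigorchuk)
qed

section \<open>The dihedral subgroup generated by a and d\<close>

definition dihedral :: "(bool list \<Rightarrow> bool list) set" where
  "dihedral = {id, grig_a, grig_d, grig_a \<circ> grig_d, grig_d \<circ> grig_a,
     grig_a \<circ> (grig_d \<circ> grig_a), grig_d \<circ> (grig_a \<circ> grig_d),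
     grig_a \<circ> (grig_d \<circ> (grig_a \<circ> grig_d))}"

text \<open>Both sides are (b, b) on level one, so (ad)^4 = 1.\<close>

lemma ad_order_4:
  "grig_d \<circ> (grig_a \<circ> (grig_d \<circ> grig_a)) = grig_a \<circ> (grig_d \<circ> (grig_a \<circ> grig_d))"
proof -
  have "node False id grig_b \<circ> (node True id id \<circ> (node False id grig_b \<circ> node True id id)) =
    node True id id \<circ> (node False id grig_b \<circ> (node True id id \<circ> node False id grig_b))"
    by (simp add: node_comp)
  then show ?thesis by (simp only: grig_node(1,4) [symmetric])
qed

lemma involution_cancel: "s \<circ> s = id \<Longrightarrow> s \<circ> (s \<circ> f) = f"
  by (simp add: comp_assoc [symmetric])

lemma dihedral_a: "f \<in> dihedral \<Longrightarrow> grig_a \<circ> f \<in> dihedral"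
  by (auto simp: dihedral_def grig_a_sq involution_cancel [OF grig_a_sq])

lemma dihedral_d:
  assumes "f \<in> dihedral"
  shows "grig_d \<circ> f \<in> dihedral"
proof -
  \<comment> \<open>The only word growing beyond the list is dadad; rewriting adad as dada cancels
    it to ada.\<close>
  have "grig_d \<circ> (grig_a \<circ> (grig_d \<circ> (grig_a \<circ> grig_d))) = grig_a \<circ> (grig_d \<circ> grig_a)"
    using ad_order_4 involution_cancel klein(3) by metis
  with assms show ?thesis
    by (auto simp: dihedral_def klein involution_cancel [OF klein(3)] ad_order_4)
qed

lemma dihedral_subset: "dihedral \<subseteq> grigorchuk"
  using grigorchuk_id grigorchuk_gens grigorchuk_comp by (simp add: dihedral_def)

text \<open>The hypotheses say that the image in the order 8 quotient is trivial; of the eight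
  listed words only \<open>id\<close> satisfies them.\<close>

lemma dihedral_faithful:
  assumes "f \<in> dihedral" "\<not> root_bit f" "par1 f = par2 f" "twist f = par2 f"
  shows "f = id"
proof -
  have "grig_a \<in> grigorchuk" "grig_d \<in> grigorchuk" using grigorchuk_gens by auto
  with assms show ?thesis
    by (auto simp: dihedral_def quotient_comp grigorchuk_comp root_bit_gens quotient_gens)
qed

section \<open>Section pairs of elements fixing level one\<close>

definition stab_pair :: "(bool list \<Rightarrow> bool list) \<Rightarrow> (bool list \<Rightarrow> bool list) \<Rightarrow> bool" where
  "stab_pair f g \<longleftrightarrow> node False f g \<in> grigorchuk"

lemma stab_pair_comp: "stab_pair f g \<Longrightarrow> stab_pair f' g' \<Longrightarrow> stab_pair (f' \<circ> f) (g' \<circ> g)"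
  unfolding stab_pair_def
  by (drule (1) grigorchuk_comp) (simp add: node_comp)

lemma stab_pair_swap:
  assumes "stab_pair f g"
  shows "stab_pair g f"
proof -
  \<comment> \<open>Conjugation by a exchanges the two sections.\<close>
  have "node True id id \<circ> (node False f g \<circ> node True id id) \<in> grigorchuk"
    using assms grigorchuk_gens [of grig_a] grigorchuk_comp
    by (simp add: stab_pair_def grig_node(1) [symmetric])
  then show ?thesis by (simp add: node_comp stab_pair_def)
qed

lemma stab_pair_gens: "stab_pair grig_a grig_c" "stab_pair grig_a grig_d" "stab_pair id grig_b"
  using grigorchuk_gens by (simp_all add: stab_pair_def grig_node(2-4) [symmetric])

lemma stab_pair_dihedral:
  assumes "f \<in> grigorchuk"
  obtains e where "e \<in> dihedral" "stab_pair e f"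
proof -
  have "\<exists>e\<in>dihedral. stab_pair e f"
    using assms
  proof (induction rule: grigorchuk_induct)
    case id
    have "id \<in> dihedral" "stab_pair id id"
      using grigorchuk_id by (simp_all add: stab_pair_def node_id dihedral_def)
    then show ?case by blast
  next
    case (step f s)
    then obtain e where e: "e \<in> dihedral" "stab_pair e f" by blast
    \<comment> \<open>Every generator occurs as a right section opposite an element of the dihedral
      group: aca = (d, a), d = (1, b), b = (a, c), c = (a, d).\<close>
    have "stab_pair (grig_d \<circ> e) (grig_a \<circ> f)" "stab_pair (id \<circ> e) (grig_b \<circ> f)"
      "stab_pair (grig_a \<circ> e) (grig_c \<circ> f)" "stab_pair (grig_a \<circ> e) (grig_d \<circ> f)"
      using stab_pair_comp [OF e(2)] stab_pair_gens stab_pair_swap by blast+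
    then show ?case
      using step(2) e(1) dihedral_a dihedral_d by (metis id_comp insert_iff singletonD)
  qed
  then show ?thesis using that by blast
qed

lemma stab_pair_matching:
  assumes "stab_pair f g"
  shows "matching f g"
  using matching_sections [OF assms [unfolded stab_pair_def]] by simp

text \<open>The dihedral subgroup embeds into the quotient by the normal closure of \<open>b\<close>. So if \<open>h\<close> is
  trivial in this quotient, a dihedral \<open>e\<close> paired with \<open>h\<close> must be \<open>id\<close>; correcting a pair
  \<open>(f, k)\<close> by such a pair \<open>(id, h)\<close> reaches every \<open>(f, g)\<close> that matches.\<close>

lemma stab_pair_iff:
  assumes f: "f \<in> grigorchuk" and g: "g \<in> grigorchuk"
  shows "stab_pair f g \<longleftrightarrow> matching f g"
proof
  assume m: "matching f g"
  obtain k where k: "k \<in> dihedral" "stab_pair f k"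
    using stab_pair_dihedral [OF f] stab_pair_swap by metis
  have kG: "k \<in> grigorchuk" using k dihedral_subset by auto
  obtain k' where k': "k' \<in> grigorchuk" "k' \<circ> k = id" using grigorchuk_inverse [OF kG] .
  define h where "h = g \<circ> k'"
  have hG: "h \<in> grigorchuk" unfolding h_def using k' g by (simp add: grigorchuk_comp)
  have h: "h \<circ> k = g" using k' by (simp add: h_def comp_assoc)
  obtain e where e: "e \<in> dihedral" "stab_pair e h" using stab_pair_dihedral [OF hG] .
  have "\<not> root_bit h \<and> par1 h = par2 h \<and> twist h = par2 h"
    using m stab_pair_matching [OF k(2)] unfolding h [symmetric] matching_def quotient_comp [OF kG hG]
    by (cases "root_bit h") auto
  then have "\<not> root_bit e \<and> par1 e = par2 e \<and> twist e = par2 e"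
    using stab_pair_matching [OF e(2)] unfolding matching_def by (cases "root_bit h") auto
  then have "e = id" using dihedral_faithful e(1) by blast
  then show "stab_pair f g" using stab_pair_comp [OF k(2) e(2)] h by simp
qed (rule stab_pair_matching)

lemma node_grigorchuk_iff:
  "node \<alpha> f g \<in> grigorchuk \<longleftrightarrow> f \<in> grigorchuk \<and> g \<in> grigorchuk \<and> matching f g"
proof
  assume "node \<alpha> f g \<in> grigorchuk"
  then show "f \<in> grigorchuk \<and> g \<in> grigorchuk \<and> matching f g"
    using sec_grigorchuk [of _ False] sec_grigorchuk [of _ True] matching_sections
    by (metis (full_types) sec_node)
next
  assume "f \<in> grigorchuk \<and> g \<in> grigorchuk \<and> matching f g"
  then have *: "node False f g \<in> grigorchuk" using stab_pair_iff stab_pair_def by blast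
  \<comment> \<open>Since a has trivial sections, multiplying by it changes only the root
    permutation.\<close>
  then have "node True id id \<circ> node False f g \<in> grigorchuk"
    using grigorchuk_gens [of grig_a] grigorchuk_comp by (simp add: grig_node(1) [symmetric])
  then have "node True f g \<in> grigorchuk" by (simp add: node_comp)
  with * show "node \<alpha> f g \<in> grigorchuk" by (cases \<alpha>) auto
qed

section \<open>Counting portraits\<close>

definition depth_set :: "nat \<Rightarrow> (bool list \<Rightarrow> bool list) set" where
  "depth_set n = {g \<in> grigorchuk. depth grigorchuk g \<le> n}"

lemma depth_set_0: "depth_set 0 = grig_nucleus"
proof -
  have "contracting_set grigorchuk (nucleus grigorchuk)"
    using contracting_grig_nucleus nucleus_grigorchuk by simp
  then show ?thesis
    using depth_le_0_iff nucleus_grigorchuk grig_nucleus_subset unfolding depth_set_def by blast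
qed

lemma node_depth_set_iff:
  "node \<alpha> f g \<in> depth_set (Suc n) \<longleftrightarrow> f \<in> depth_set n \<and> g \<in> depth_set n \<and> matching f g"
proof (cases "node \<alpha> f g \<in> grigorchuk")
  case True
  have "depth grigorchuk (node \<alpha> f g) \<le> Suc n \<longleftrightarrow>
    (\<forall>i. depth grigorchuk (sec (node \<alpha> f g) i) \<le> n)"
    using True contracting_grig_nucleus sec_grigorchuk sec_grig_nucleus
    by (intro depth_le_Suc_iff) (simp_all only: nucleus_grigorchuk)
  then show ?thesis
    using True node_grigorchuk_iff by (auto simp: depth_set_def all_bool_eq)
next
  case False
  then show ?thesis using node_grigorchuk_iff by (auto simp: depth_set_def)
qed

section \<open>Counting within the classes of the quotient\<close>

definition depth_class :: "nat \<Rightarrow> bool \<Rightarrow> bool \<Rightarrow> bool \<Rightarrow> bool \<Rightarrow> (bool list \<Rightarrow> bool list) set" where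
  "depth_class n s p q t =
    {g \<in> depth_set n. root_bit g = s \<and> par1 g = p \<and> par2 g = q \<and> twist g = t}"

definition class_count :: "nat \<Rightarrow> bool \<Rightarrow> bool \<Rightarrow> bool \<Rightarrow> bool \<Rightarrow> nat" where
  "class_count n s p q t = card (depth_class n s p q t)"

lemma node_depth_class_iff:
  "node \<alpha> f g \<in> depth_class (Suc n) s p q t \<longleftrightarrow>
    \<alpha> = s \<and> f \<in> depth_set n \<and> g \<in> depth_set n \<and> matching f g \<and>
    p = (root_bit f \<noteq> root_bit g) \<and> q = (par1 f \<noteq> par1 g) \<and> t = (root_bit g \<noteq> par1 g)"
  by (auto simp: depth_class_def node_depth_set_iff par1_def par2_def twist_def)

text \<open>Given the class of an element, the classes of its two sections are determined by
  the bits \<open>i = root_bit\<close> and \<open>j = twist\<close> of the first section.\<close>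

definition section_classes ::
    "nat \<Rightarrow> bool \<Rightarrow> bool \<Rightarrow> bool \<Rightarrow> bool \<times> bool \<Rightarrow>
      ((bool list \<Rightarrow> bool list) \<times> (bool list \<Rightarrow> bool list)) set" where
  "section_classes n p q t = (\<lambda>(i, j).
    depth_class n i ((t \<noteq> p) \<noteq> (q \<noteq> i)) (t \<noteq> q) j \<times>
    depth_class n (p \<noteq> i) (t \<noteq> (p \<noteq> i)) (t \<noteq> p)
      ((p \<noteq> q) \<noteq> (j \<noteq> (i \<and> p \<noteq> i))))"

text \<open>The definitions of p, q, t and the three conditions of \<open>matching\<close> are
  equations mod 2. For given i and j they solve successively for \<open>root_bit g\<close>,
  \<open>par1 g\<close>, \<open>par1 f\<close>, \<open>par2 f\<close>, \<open>par2 g\<close> and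
  \<open>twist g\<close>.\<close>

lemma depth_class_Suc:
  "depth_class (Suc n) s p q t =
    (\<lambda>(f, g). node s f g) ` (\<Union>ij\<in>UNIV. section_classes n p q t ij)"
proof (rule equalityI; rule subsetI)
  fix h
  assume h: "h \<in> depth_class (Suc n) s p q t"
  then have "h \<in> grigorchuk" by (simp add: depth_class_def depth_set_def)
  then obtain \<alpha> f g where hn: "h = node \<alpha> f g" by (rule grigorchuk_cases)
  have *: "\<alpha> = s" "f \<in> depth_set n" "g \<in> depth_set n" "matching f g"
    "p = (root_bit f \<noteq> root_bit g)" "q = (par1 f \<noteq> par1 g)" "t = (root_bit g \<noteq> par1 g)"
    using h unfolding hn node_depth_class_iff by auto
  then have "(f, g) \<in> section_classes n p q t (root_bit f, twist f)"
    unfolding section_classes_def depth_class_def matching_def by auto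
  then show "h \<in> (\<lambda>(f, g). node s f g) ` (\<Union>ij\<in>UNIV. section_classes n p q t ij)"
    using hn *(1) by force
next
  fix h
  assume "h \<in> (\<lambda>(f, g). node s f g) ` (\<Union>ij\<in>UNIV. section_classes n p q t ij)"
  then obtain f g i j where h: "h = node s f g" "(f, g) \<in> section_classes n p q t (i, j)"
    by auto
  then have "f \<in> depth_set n \<and> g \<in> depth_set n \<and> matching f g \<and>
    p = (root_bit f \<noteq> root_bit g) \<and> q = (par1 f \<noteq> par1 g) \<and> t = (root_bit g \<noteq> par1 g)"
    unfolding section_classes_def depth_class_def matching_def by auto
  then show "h \<in> depth_class (Suc n) s p q t"
    unfolding h(1) node_depth_class_iff by simp
qed

lemma finite_depth_set: "finite (depth_set n)"
proof (induction n)
  case 0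
  then show ?case by (simp add: depth_set_0 grig_nucleus_def)
next
  case (Suc n)
  have "depth_set (Suc n) \<subseteq> (\<lambda>(\<alpha>, f, g). node \<alpha> f g) ` (UNIV \<times> depth_set n \<times> depth_set n)"
  proof
    fix h
    assume h: "h \<in> depth_set (Suc n)"
    then have "h \<in> grigorchuk" by (simp add: depth_set_def)
    then obtain \<alpha> f g where "h = node \<alpha> f g" by (rule grigorchuk_cases)
    with h show "h \<in> (\<lambda>(\<alpha>, f, g). node \<alpha> f g) ` (UNIV \<times> depth_set n \<times> depth_set n)"
      by (force simp: node_depth_set_iff)
  qed
  then show ?case using Suc finite_subset by fastforce
qed

lemma finite_depth_class: "finite (depth_class n s p q t)"
  by (simp add: depth_class_def finite_depth_set)

text \<open>Distinct (i, j) give disjoint sets of pairs, since the bits are read off the first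
  section. The right side is free of s: a matching pair goes with either root permutation.\<close>

lemma class_count_Suc:
  "class_count (Suc n) s p q t = (\<Sum>i\<in>UNIV. \<Sum>j\<in>UNIV.
    class_count n i ((t \<noteq> p) \<noteq> (q \<noteq> i)) (t \<noteq> q) j *
    class_count n (p \<noteq> i) (t \<noteq> (p \<noteq> i)) (t \<noteq> p)
      ((p \<noteq> q) \<noteq> (j \<noteq> (i \<and> p \<noteq> i))))"
proof -
  have "inj_on (\<lambda>(f, g). node s f g) A" for A
    by (auto simp: inj_on_def)
  then have "class_count (Suc n) s p q t = card (\<Union>ij\<in>UNIV. section_classes n p q t ij)"
    unfolding class_count_def depth_class_Suc by (rule card_image)
  also have "\<dots> = (\<Sum>ij\<in>UNIV. card (section_classes n p q t ij))"
  proof (rule card_UN_disjoint)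
    show "\<forall>ij\<in>UNIV. finite (section_classes n p q t ij)"
      by (auto simp: section_classes_def finite_depth_class)
    show "\<forall>ij\<in>UNIV. \<forall>kl\<in>UNIV. ij \<noteq> kl \<longrightarrow>
      section_classes n p q t ij \<inter> section_classes n p q t kl = {}"
      by (auto simp: section_classes_def depth_class_def)
  qed simp
  also have "\<dots> = (\<Sum>i\<in>UNIV. \<Sum>j\<in>UNIV. card (section_classes n p q t (i, j)))"
    by (simp add: UNIV_Times_UNIV [symmetric] sum.cartesian_product del: UNIV_Times_UNIV)
  finally show ?thesis
    by (simp add: section_classes_def card_cartesian_product class_count_def)
qed


lemma class_count_0:
  "class_count 0 s p q t =
    (if (s, p, q, t) \<in> {(False, False, False, False), (True, False, False, False),
      (False, True, True, True), (False, True, False, False), (False, False, True, True)}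
     then 1 else 0)"
proof -
  have "depth_class 0 s p q t =
    (if (s, p, q, t) = (False, False, False, False) then {id}
     else if (s, p, q, t) = (True, False, False, False) then {grig_a}
     else if (s, p, q, t) = (False, True, True, True) then {grig_b}
     else if (s, p, q, t) = (False, True, False, False) then {grig_c}
     else if (s, p, q, t) = (False, False, True, True) then {grig_d} else {})"
    by (auto simp: depth_class_def depth_set_0 grig_nucleus_def root_bit_gens quotient_gens)
  then show ?thesis by (simp add: class_count_def)
qed

lemma card_depth_set:
  "card (depth_set n) = (\<Sum>s\<in>UNIV. \<Sum>p\<in>UNIV. \<Sum>q\<in>UNIV. \<Sum>t\<in>UNIV. class_count n s p q t)"
proof -
  have "card (depth_set n) = (\<Sum>(s, p, q, t)\<in>UNIV. card (depth_class n s p q t))"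
  proof -
    have "depth_set n = (\<Union>k\<in>UNIV. case k of (s, p, q, t) \<Rightarrow> depth_class n s p q t)"
      by (auto simp: depth_class_def)
    also have "card \<dots> = (\<Sum>k\<in>UNIV. card (case k of (s, p, q, t) \<Rightarrow> depth_class n s p q t))"
      by (rule card_UN_disjoint) (auto simp: finite_depth_set depth_class_def)
    finally show ?thesis by (simp add: case_prod_beta)
  qed
  then show ?thesis
    by (simp add: UNIV_Times_UNIV [symmetric] sum.cartesian_product class_count_def del: UNIV_Times_UNIV)
qed

theorem theorem4p2:
  fixes x y z X Y Z :: "nat \<Rightarrow> nat"
  assumes "x 1 = 1" and "y 1 = 1" and "z 1 = 1" and "X 1 = 2" and "Y 1 = 1" and "Z 1 = 0"
    and "\<And>n. n \<ge> 1 \<Longrightarrow> x (n + 1) = (x n)^2 + 2 * (y n)^2 + (z n)^2"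
    and "\<And>n. n \<ge> 1 \<Longrightarrow> y (n + 1) = x n * Y n + Y n * z n + X n * y n + y n * Z n"
    and "\<And>n. n \<ge> 1 \<Longrightarrow> z (n + 1) = (X n)^2 + 2 * (Y n)^2 + (Z n)^2"
    and "\<And>n. n \<ge> 1 \<Longrightarrow> X (n + 1) = 2 * x n * y n + 2 * y n * z n"
    and "\<And>n. n \<ge> 1 \<Longrightarrow> Y (n + 1) = x n * X n + 2 * y n * Y n + z n * Z n"
    and "\<And>n. n \<ge> 1 \<Longrightarrow> Z (n + 1) = 2 * X n * Y n + 2 * Y n * Z n"
  shows "portrait_growth grigorchuk 0 = 5 \<and>
    (\<forall>n\<ge>1. portrait_growth grigorchuk n =
       2 * x n + 4 * y n + 2 * z n + 2 * X n + 4 * Y n + 2 * Z n)"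
proof (intro conjI allI impI)
  have growth: "portrait_growth grigorchuk n = card (depth_set n)" for n
    by (simp add: portrait_growth_def depth_set_def)
  show "portrait_growth grigorchuk 0 = 5"
    by (simp add: growth card_depth_set class_count_0 UNIV_bool)
  \<comment> \<open>The free bit s gives the factor 2 in every coefficient of the final sum; the
    free bit t doubles those of y and Y again.\<close>
  have classes: "\<forall>s. class_count n s False False False = x n \<and> class_count n s False False True = z n \<and>
    class_count n s True True True = X n \<and> class_count n s True True False = Z n \<and>
    (\<forall>t. class_count n s True False t = y n \<and> class_count n s False True t = Y n)"
    if "n \<ge> 1" for n
    using that
  proof (induction n rule: nat_induct_at_least)
    case base
    show ?case
      \<comment> \<open>The recursion reduces level 1 to the five nucleus classes. Level 0 cannot be
        the base: there a alone moves level one, so the counts depend on s.\<close>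
      unfolding One_nat_def class_count_Suc
      using assms(1-6) by (simp add: class_count_0 UNIV_bool all_bool_eq)
  next
    case (Suc n)
    have rec: "x (Suc n) = (x n)^2 + 2 * (y n)^2 + (z n)^2"
      "y (Suc n) = x n * Y n + Y n * z n + X n * y n + y n * Z n"
      "z (Suc n) = (X n)^2 + 2 * (Y n)^2 + (Z n)^2"
      "X (Suc n) = 2 * x n * y n + 2 * y n * z n"
      "Y (Suc n) = x n * X n + 2 * y n * Y n + z n * Z n"
      "Z (Suc n) = 2 * X n * Y n + 2 * Y n * Z n"
      using assms(7-12) [OF Suc(1)] by simp_all
    show ?case
      unfolding class_count_Suc rec using Suc.IH
      by (simp add: UNIV_bool all_bool_eq power2_eq_square algebra_simps)
  qed
  fix n :: nat
  assume "n \<ge> 1"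
  from classes [OF this] show "portrait_growth grigorchuk n =
    2 * x n + 4 * y n + 2 * z n + 2 * X n + 4 * Y n + 2 * Z n"
    by (simp add: growth card_depth_set UNIV_bool)
qed

end
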